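(* Let $M$ be a finite set of $m$ candidates, $N$ a set of $n$ voters with preference profile $\vec Q\in(\pi(M))^n$, and $r\ge 0$ an integer. Suppose that all voters are strategic voters of type $r$ (with respect to the $\ell_1$ distance) in Plurality voting. Then a voting equilibrium exists. Moreover, in an iterative setting where voters start from the truthful state $\vec q=(q_i)_{i\in N}$, for any singleton scheduler, they converge to a voting equilibrium in at most $n(m-1)$ steps.
   Context: **Plurality game.** $\pi(M)$ is the set of strict total orders on $M$. Voter $i$ has preference order $Q_i\in\pi(M)$, where $Q_i(a)\in\{1,\dots,m\}$ is the rank of $a$; $a\succ_i b$ iff $Q_i(a)<Q_i(b)$. The most preferred candidate of $i$ is $q_i$, i.e. $Q_i(q_i)=1$. A voting profile is $\vec a=(a_i)_{i\in N}\in M^n$; $\vec a_{-i}$ is the profile of all voters but $i$. A state is a score vector $\vec s\in\mathbb N^M$ (with $0\in\mathbb N$); a full or partial profile $\vec a$ induces the state $\vec s_{\vec a}$ with $s_{\vec a}(c)$ = number of voters in it voting for $c$. Plurality $f$ selects the candidate with the highest score, ties broken by a fixed strict order $\overline Q$ on $M$; $f(\vec a)=f(\vec s_{\vec a})$. For a state $\vec s$ and a vote $c\in M$, $(\vec s,c)$ is the state obtained by adding one vote to $c$, and $f(\vec s,c)$ is its winner. **Local dominance.** For a set of states $S$, action $b$ $S$-beats action $a$ (w.r.t. voter $i$) if there is $\vec s\in S$ with $f(\vec s,b)\succ_i f(\vec s,a)$. Action $b$ $S$-dominates $a$ if $b$ $S$-beats $a$ and $a$ does not $S$-beat $b$. For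 the $\ell_1$ distance, $S_i(\vec a,r)=\{\vec s'\in\mathbb N^M:\sum_{c\in M}|s'(c)-s_{\vec a_{-i}}(c)|\le r\}$. **Strategic voter of type $r$.** In profile $\vec a$, let $D\subseteq M$ be the set of candidates that $S_i(\vec a,r)$-dominate $a_i$. The response is $g_i(\vec a)=\arg\min_{d\in D}Q_i(d)$ if $D\ne\emptyset$, and $g_i(\vec a)=a_i$ otherwise. A voting equilibrium is a profile $\vec a$ with $g_i(\vec a)=a_i$ for all $i\in N$. **Iterative setting.** A singleton scheduler selects at each step, arbitrarily, a single voter $i$ having a strategic step (i.e. $g_i(\vec a)\ne a_i$) in the current profile $\vec a$; that voter changes her vote to $g_i(\vec a)$ while all other votes are unchanged. The process stops when no voter has a strategic step. *)

theory Defs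
  imports "HOL-Library.Cardinality"
begin

text \<open>
  Candidates are the elements of a finite type \<open>'c\<close> (nonempty, as any voting game requires), and
  voters are the members of a finite set \<open>N :: 'v set\<close>.  A strict total order on the candidates is
  given by its rank function, with rank 1 for the top candidate.
\<close>

type_synonym 'c ranking = "'c \<Rightarrow> nat"
type_synonym ('v, 'c) profile = "'v \<Rightarrow> 'c"
type_synonym 'c state = "'c \<Rightarrow> nat"

definition strict_ranking :: "'c::finite ranking \<Rightarrow> bool" where
  "strict_ranking R \<longleftrightarrow> bij_betw R UNIV {1..CARD('c)}"

definition top_choice :: "'c::finite ranking \<Rightarrow> 'c" where
  "top_choice R = (THE c. R c = 1)"

text \<open>
  The voter set \<open>V\<close> is an argument so that the partial profile \<open>a\<^sub>-\<^sub>i\<close> is scored by taking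
  \<open>V = N - {i}\<close>.  Values of a profile outside the voter set never matter.
\<close>

definition score :: "'v set \<Rightarrow> ('v, 'c) profile \<Rightarrow> 'c state" where
  "score V a = (\<lambda>c. card {i \<in> V. a i = c})"

definition add_vote :: "'c state \<Rightarrow> 'c \<Rightarrow> 'c state" where
  "add_vote s c = s(c := s c + 1)"

definition plurality :: "'c::finite ranking \<Rightarrow> 'c state \<Rightarrow> 'c" where
  "plurality T s = (ARG_MIN T c. \<forall>d. s d \<le> s c)"

text \<open>Below, \<open>T\<close> is the tie-breaking order and \<open>P\<close> the preference order of the voter concerned.\<close>

definition beats ::
  "'c::finite ranking \<Rightarrow> 'c ranking \<Rightarrow> 'c state set \<Rightarrow> 'c \<Rightarrow> 'c \<Rightarrow> bool" where
  "beats T P S b a \<longleftrightarrow>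
     (\<exists>s\<in>S. P (plurality T (add_vote s b)) < P (plurality T (add_vote s a)))"

definition dominates ::
  "'c::finite ranking \<Rightarrow> 'c ranking \<Rightarrow> 'c state set \<Rightarrow> 'c \<Rightarrow> 'c \<Rightarrow> bool" where
  "dominates T P S b a \<longleftrightarrow> beats T P S b a \<and> \<not> beats T P S a b"

definition possible_states ::
  "'v set \<Rightarrow> nat \<Rightarrow> 'v \<Rightarrow> ('v, 'c::finite) profile \<Rightarrow> 'c state set" where
  "possible_states N r i a =
     {s. (\<Sum>c\<in>UNIV. \<bar>int (s c) - int (score (N - {i}) a c)\<bar>) \<le> int r}"

definition response ::
  "'v set \<Rightarrow> ('v \<Rightarrow> 'c::finite ranking) \<Rightarrow> 'c ranking \<Rightarrow> nat \<Rightarrow> 'v \<Rightarrow> ('v, 'c) profile \<Rightarrow> 'c" where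
  "response N Q T r i a =
     (let D = {d. dominates T (Q i) (possible_states N r i a) d (a i)}
      in if D \<noteq> {} then (ARG_MIN (Q i) d. d \<in> D) else a i)"

definition voting_equilibrium ::
  "'v set \<Rightarrow> ('v \<Rightarrow> 'c::finite ranking) \<Rightarrow> 'c ranking \<Rightarrow> nat \<Rightarrow> ('v, 'c) profile \<Rightarrow> bool" where
  "voting_equilibrium N Q T r a \<longleftrightarrow> (\<forall>i\<in>N. response N Q T r i a = a i)"

text \<open>
  \<open>A t\<close> is the profile after \<open>t\<close> steps and \<open>\<sigma> t\<close> the voter scheduled in it.  The process stops when no
  voter has a strategic step; a stopped process is represented by a constant continuation of \<open>A\<close>, and
  the value of \<open>\<sigma>\<close> is then irrelevant.  As \<open>\<sigma>\<close> and \<open>A\<close> are constrained only jointly, history-dependent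
  schedulers are covered.
\<close>

definition singleton_iteration ::
  "'v set \<Rightarrow> ('v \<Rightarrow> 'c::finite ranking) \<Rightarrow> 'c ranking \<Rightarrow> nat \<Rightarrow> ('v, 'c) profile
     \<Rightarrow> (nat \<Rightarrow> 'v) \<Rightarrow> (nat \<Rightarrow> ('v, 'c) profile) \<Rightarrow> bool" where
  "singleton_iteration N Q T r a0 \<sigma> A \<longleftrightarrow> A 0 = a0 \<and>
     (\<forall>t. if \<exists>i\<in>N. response N Q T r i (A t) \<noteq> A t i
          then \<sigma> t \<in> N \<and> response N Q T r (\<sigma> t) (A t) \<noteq> A t (\<sigma> t)
               \<and> A (Suc t) = (A t)(\<sigma> t := response N Q T r (\<sigma> t) (A t))
          else A (Suc t) = A t)"

end

theory Submission
  imports Defs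
begin

text \<open>
  Encode score and tie-breaking in one integer weight, so that the winner is the candidate of maximal
  weight and one vote is worth \<open>m\<close>.  Call a candidate a contender, at the scores \<open>p\<close> of the other
  voters, if \<open>r + 1\<close> further votes would lift it above all others.  Only contenders can win in a
  state considered possible, and a contender other than the winner of \<open>p\<close> can be made pivotal
  against that winner by adding votes to it alone.

  Along an iteration from the truthful profile, no candidate that a voter prefers to her current vote
  is a contender for her.  Under this invariant a voter whose vote is a contender does not move, and
  any other voter moves, if at all, to her favourite contender, which is worse for her than her
  current vote.  Such a move takes a vote from a non-contender and gives it to a contender, so
  candidates that are hopeless for another voter stay hopeless.  As ranks only grow, the number of
  steps is at most \<open>n (m - 1)\<close>.
\<close>

section \<open>Weights and the \<open>l1\<close> ball of states\<close>

definition weight :: "'c::finite ranking \<Rightarrow> 'c state \<Rightarrow> 'c \<Rightarrow> int" where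
  "weight T s c = int CARD('c) * int (s c) - int (T c)"

text \<open>Of the \<open>r + 1\<close> votes, \<open>r\<close> come from the radius of the ball and
  one is the voter's own. The instance \<open>d = c\<close> holds trivially.\<close>

definition contenders :: "'c::finite ranking \<Rightarrow> nat \<Rightarrow> 'c state \<Rightarrow> 'c set" where
  "contenders T r p = {c. \<forall>d. weight T p d < weight T p c + int CARD('c) * (int r + 1)}"

definition state_ball :: "nat \<Rightarrow> 'c::finite state \<Rightarrow> 'c state set" where
  "state_ball r p = {s. (\<Sum>c\<in>UNIV. \<bar>int (s c) - int (p c)\<bar>) \<le> int r}"

lemma possible_states_eq: "possible_states N r i a = state_ball r (score (N - {i}) a)"
  by (simp add: possible_states_def state_ball_def)

lemma weight_upd:
  fixes T :: "'c::finite ranking"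
  shows "weight T (s(e := s e + x)) c = weight T s c + (if c = e then int CARD('c) * int x else 0)"
  by (simp add: weight_def algebra_simps)

lemma weight_add_vote:
  fixes T :: "'c::finite ranking"
  shows "weight T (add_vote s e) c = weight T s c + (if c = e then int CARD('c) else 0)"
  by (simp add: add_vote_def weight_def algebra_simps)

lemma weight_change:
  fixes T :: "'c::finite ranking"
  shows "\<bar>weight T s c - weight T p c\<bar> = int CARD('c) * \<bar>int (s c) - int (p c)\<bar>"
proof -
  have "weight T s c - weight T p c = int CARD('c) * (int (s c) - int (p c))"
    by (simp add: weight_def algebra_simps)
  then show ?thesis
    by (simp add: abs_mult)
qed

text \<open>A unit of \<open>l1\<close> distance is spent on a single candidate, so it shifts the
  gap between two candidates by at most \<open>CARD('c)\<close>. Hence adding votes to the trailing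
  one is already an optimal use of the budget.\<close>

lemma state_ball_weight_diff:
  fixes T :: "'c::finite ranking"
  assumes "s \<in> state_ball r p" and "c \<noteq> d"
  shows "weight T p d - weight T p c \<le> weight T s d - weight T s c + int CARD('c) * int r"
proof -
  let ?\<delta> = "\<lambda>c. \<bar>int (s c) - int (p c)\<bar>"
  have "?\<delta> c + ?\<delta> d = (\<Sum>e\<in>{c, d}. ?\<delta> e)"
    using assms(2) by simp
  also have "\<dots> \<le> (\<Sum>e\<in>UNIV. ?\<delta> e)"
    by (rule sum_mono2) auto
  also have "\<dots> \<le> int r"
    using assms(1) by (simp add: state_ball_def)
  finally have "int CARD('c) * (?\<delta> c + ?\<delta> d) \<le> int CARD('c) * int r"
    by (intro mult_left_mono) auto
  then have "\<bar>weight T s c - weight T p c\<bar> + \<bar>weight T s d - weight T p d\<bar> \<le> int CARD('c) * int r"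
    by (simp add: weight_change distrib_left)
  then show ?thesis
    by linarith
qed

lemma upd_in_state_ball:
  assumes "x \<le> r"
  shows "p(c := p c + x) \<in> state_ball r p"
proof -
  have "(\<Sum>d\<in>UNIV. \<bar>int ((p(c := p c + x)) d) - int (p d)\<bar>) = (\<Sum>d\<in>UNIV. if d = c then int x else 0)"
    by (intro sum.cong) auto
  then show ?thesis
    using assms by (simp add: state_ball_def)
qed

lemma score_insert_voter:
  assumes "finite N" and "i \<in> N"
  shows "score N a = add_vote (score (N - {i}) a) (a i)"
proof
  fix c
  have "{j \<in> N. a j = c} = (if a i = c then insert i {j \<in> N - {i}. a j = c} else {j \<in> N - {i}. a j = c})"
    using assms(2) by auto
  then show "score N a c = add_vote (score (N - {i}) a) (a i) c"
    using assms(1) by (simp add: score_def add_vote_def)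
qed

lemma score_upd_outside: "i \<notin> V \<Longrightarrow> score V (a(i := x)) = score V a"
  unfolding score_def by (intro ext arg_cong[where f = card]) auto

lemma strict_ranking_inj: "strict_ranking R \<Longrightarrow> R c = R d \<Longrightarrow> c = d"
  unfolding strict_ranking_def bij_betw_def by (auto dest: injD)

lemma strict_ranking_range:
  fixes R :: "'c::finite ranking"
  assumes "strict_ranking R"
  shows "1 \<le> R c \<and> R c \<le> CARD('c)"
proof -
  have "R c \<in> R ` UNIV" by simp
  then show ?thesis
    using assms by (auto simp: strict_ranking_def bij_betw_def)
qed

lemma rank_top_choice:
  fixes R :: "'c::finite ranking"
  assumes "strict_ranking R"
  shows "R (top_choice R) = 1"
proof -
  have "1 \<in> {1..CARD('c)}" by (simp add: Suc_leI)
  then have "1 \<in> R ` UNIV"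
    using assms by (simp add: strict_ranking_def bij_betw_def)
  then obtain c where "R c = 1" by (metis imageE)
  then have "\<exists>!c. R c = 1"
    using strict_ranking_inj[OF assms] by metis
  then show ?thesis
    unfolding top_choice_def by (rule theI')
qed

section \<open>Plurality as maximal weight\<close>

context
  fixes T :: "'c::finite ranking"
  assumes T: "strict_ranking T"
begin

text \<open>Equal weights force \<open>CARD('c)\<close> to divide a difference of two tie-breaking
  ranks, which is smaller than \<open>CARD('c)\<close> in absolute value.\<close>

lemma weight_inj:
  assumes "weight T s c = weight T s d"
  shows "c = d"
proof -
  have "int (T c) - int (T d) = int CARD('c) * (int (s c) - int (s d))"
    using assms by (simp add: weight_def algebra_simps)
  then have dvd: "int CARD('c) dvd int (T c) - int (T d)"
    by simp
  have "\<bar>int (T c) - int (T d)\<bar> < int CARD('c)"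
    using strict_ranking_range[OF T, of c] strict_ranking_range[OF T, of d] by linarith
  then have "int (T c) - int (T d) = 0"
    using dvd_imp_le_int[OF _ dvd] by linarith
  then show ?thesis
    using strict_ranking_inj[OF T] by simp
qed

lemma score_less_imp_weight_less:
  assumes "s c < s d"
  shows "weight T s c < weight T s d"
proof -
  have "int CARD('c) * (int (s c) + 1) \<le> int CARD('c) * int (s d)"
    using assms by (intro mult_left_mono) auto
  then show ?thesis
    using strict_ranking_range[OF T, of c] strict_ranking_range[OF T, of d]
    unfolding weight_def distrib_left by linarith
qed

lemma plurality_eqI:
  assumes "\<And>d. weight T s d \<le> weight T s w"
  shows "plurality T s = w"
proof -
  have max: "s d \<le> s w" for d
    using assms[of d] score_less_imp_weight_less[of s w d] by (meson not_le)
  have le: "T w \<le> T d" if "\<forall>e. s e \<le> s d" for d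
  proof -
    have "s d = s w" using that max by (simp add: le_antisym)
    then show ?thesis using assms[of d] by (simp add: weight_def)
  qed
  have "(\<forall>d. s d \<le> s (plurality T s)) \<and> T (plurality T s) \<le> T w"
    unfolding plurality_def
    using arg_min_nat_lemma[of "\<lambda>c. \<forall>d. s d \<le> s c" w T] max by blast
  then show ?thesis
    using le strict_ranking_inj[OF T] by (meson le_antisym)
qed

lemma weight_le_plurality: "weight T s d \<le> weight T s (plurality T s)"
proof -
  have fin: "finite (range (weight T s))" by simp
  obtain w where w: "Max (range (weight T s)) = weight T s w"
    using Max_in[OF fin] by blast
  have "weight T s e \<le> weight T s w" for e
    unfolding w[symmetric] by (simp add: fin)
  then show ?thesis
    using plurality_eqI[of s w] by simp
qed

lemma weight_less_plurality:
  "d \<noteq> plurality T s \<Longrightarrow> weight T s d < weight T s (plurality T s)"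
  using weight_le_plurality[of s d] weight_inj[of s d] by (metis order_le_less)

lemma plurality_add_vote: "plurality T (add_vote s e) = plurality T s \<or> plurality T (add_vote s e) = e"
proof (rule disjCI)
  assume ne: "plurality T (add_vote s e) \<noteq> e"
  let ?w = "plurality T (add_vote s e)"
  have "weight T s d \<le> weight T s ?w" for d
    using weight_le_plurality[of "add_vote s e" d] ne by (simp add: weight_add_vote split: if_splits)
  then show "?w = plurality T s"
    using plurality_eqI by metis
qed

section \<open>Contenders and pivotal states\<close>

lemma contenderI:
  assumes s: "s \<in> state_ball r p" and "\<And>d. weight T s d < weight T s c + int CARD('c)"
  shows "c \<in> contenders T r p"
  unfolding contenders_def
proof (intro CollectI allI)
  fix d
  show "weight T p d < weight T p c + int CARD('c) * (int r + 1)"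
  proof (cases "d = c")
    case False
    then show ?thesis
      using state_ball_weight_diff[OF s, of c d T] assms(2)[of d] by (simp add: distrib_left)
  qed simp
qed

lemma plurality_add_vote_contender:
  assumes "s \<in> state_ball r p"
  shows "plurality T (add_vote s e) \<in> contenders T r p"
proof (rule contenderI[OF assms])
  let ?w = "plurality T (add_vote s e)"
  fix d
  show "weight T s d < weight T s ?w + int CARD('c)"
    using weight_less_plurality[of d "add_vote s e"]
    by (cases "d = ?w") (auto simp: weight_add_vote split: if_splits)
qed

lemma plurality_contender:
  assumes "s \<in> state_ball r p"
  shows "plurality T s \<in> contenders T r p"
proof (rule contenderI[OF assms])
  fix d
  show "weight T s d < weight T s (plurality T s) + int CARD('c)"
    using weight_le_plurality[of s d] by (simp add: order_le_less_trans)
qed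

text \<open>One vote can only make its own recipient the new winner, and winners are contenders. A
  voter on a non-contender thus compares every alternative with the winner of \<open>s\<close>
  itself.\<close>

lemma non_contender_vote:
  assumes "a \<notin> contenders T r p" and "s \<in> state_ball r p"
  shows "plurality T (add_vote s a) = plurality T s"
  using assms plurality_add_vote plurality_add_vote_contender by metis

lemma contender_pivotal:
  assumes c: "c \<in> contenders T r p" and ne: "c \<noteq> plurality T p"
  shows "\<exists>s\<in>state_ball r p. plurality T s = plurality T p \<and> plurality T (add_vote s c) = c"
proof -
  let ?w = "plurality T p" and ?m = "int CARD('c)"
  let ?P = "\<lambda>x. weight T p ?w < weight T p c + ?m * (int x + 1)"
  \<comment> \<open>The least number of extra votes after which one further vote lifts
    \<open>c\<close> above \<open>?w\<close>. By minimality \<open>c\<close> does not yet overtake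
    \<open>?w\<close> without that vote.\<close>
  define x where "x = (LEAST x. ?P x)"
  have r: "?P r"
    using c by (simp add: contenders_def)
  have x: "?P x" "x \<le> r"
    unfolding x_def using r by (rule LeastI, rule Least_le)
  have le: "weight T p c + ?m * int x \<le> weight T p ?w"
  proof (cases x)
    case 0
    then show ?thesis using weight_le_plurality by simp
  next
    case (Suc y)
    then have "\<not> ?P y" unfolding x_def using not_less_Least by (metis lessI)
    then show ?thesis using Suc by (simp add: add.commute)
  qed
  let ?s = "p(c := p c + x)"
  have "plurality T ?s = ?w"
    by (rule plurality_eqI) (use le ne weight_le_plurality in \<open>auto simp: weight_upd\<close>)
  moreover have "plurality T (add_vote ?s c) = c"
  proof (rule plurality_eqI)
    fix d
    show "weight T (add_vote ?s c) d \<le> weight T (add_vote ?s c) c"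
      using x(1) weight_le_plurality[of p d] by (simp add: weight_add_vote weight_upd distrib_left)
  qed
  ultimately show ?thesis
    using upd_in_state_ball[OF x(2)] by blast
qed

text \<open>The counterpart of \<open>contender_pivotal\<close> for the winner of \<open>p\<close>.
  That winner may be unbeatable in the whole ball, so a state \<open>s\<close> with another winner
  is required. The rival gets just enough votes to overtake, and a single vote then restores the old
  winner.\<close>

lemma winner_pivotal:
  assumes s: "s \<in> state_ball r p" and ne: "plurality T s \<noteq> plurality T p"
  shows "\<exists>s'\<in>state_ball r p. plurality T s' = plurality T s
    \<and> plurality T (add_vote s' (plurality T p)) = plurality T p"
proof -
  let ?w = "plurality T p" and ?c = "plurality T s" and ?m = "int CARD('c)"
  let ?P = "\<lambda>x. weight T p ?w < weight T p ?c + ?m * int x"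
  define x where "x = (LEAST x. ?P x)"
  have r: "?P r"
    using state_ball_weight_diff[OF s ne, of T] weight_less_plurality[OF ne[symmetric]] by linarith
  have x: "?P x" "x \<le> r"
    unfolding x_def using r by (rule LeastI, rule Least_le)
  have "x \<noteq> 0"
    using x(1) weight_le_plurality[of p ?c] by (metis add.right_neutral mult_zero_right not_le of_nat_0)
  then obtain y where y: "x = Suc y" by (cases x) auto
  then have "\<not> ?P y" unfolding x_def using not_less_Least by (metis lessI)
  then have le: "weight T p ?c + ?m * int x \<le> weight T p ?w + ?m"
    using y by (simp add: distrib_left)
  let ?s = "p(?c := p ?c + x)"
  have "plurality T ?s = ?c"
  proof (rule plurality_eqI)
    fix d
    show "weight T ?s d \<le> weight T ?s ?c"
      using x(1) weight_le_plurality[of p d] by (simp add: weight_upd)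
  qed
  moreover have "plurality T (add_vote ?s ?w) = ?w"
  proof (rule plurality_eqI)
    fix d
    show "weight T (add_vote ?s ?w) d \<le> weight T (add_vote ?s ?w) ?w"
      using le ne weight_le_plurality[of p d] by (auto simp: weight_add_vote weight_upd)
  qed
  ultimately show ?thesis
    using upd_in_state_ball[OF x(2)] by blast
qed

section \<open>Local dominance in terms of contenders\<close>

text \<open>In a state where \<open>a\<close> is pivotal, voting \<open>a\<close> elects the
  favourite contender, while voting \<open>d\<close> elects some other contender, which is strictly
  worse. So \<open>a\<close> beats \<open>d\<close>.\<close>

lemma favourite_contender_undominated:
  assumes P: "strict_ranking P"
    and a: "a \<in> contenders T r p" and fav: "\<And>c. c \<in> contenders T r p \<Longrightarrow> P a \<le> P c"
  shows "\<not> dominates T P (state_ball r p) d a"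
proof
  assume dom: "dominates T P (state_ball r p) d a"
  then obtain s where s: "s \<in> state_ball r p"
    and better: "P (plurality T (add_vote s d)) < P (plurality T (add_vote s a))"
    by (auto simp: dominates_def beats_def)
  then have "a \<noteq> d" by auto
  have "plurality T (add_vote s a) \<noteq> a"
    using better fav[OF plurality_add_vote_contender[OF s, of d]] by auto
  \<comment> \<open>Needed when \<open>a\<close> wins at \<open>p\<close>: it shows that this win is
    not certain, as \<open>winner_pivotal\<close> requires.\<close>
  then have sa: "plurality T s \<noteq> a"
    using plurality_add_vote[of s a] by (metis)
  have "\<exists>s'\<in>state_ball r p. plurality T s' \<noteq> a \<and> plurality T (add_vote s' a) = a"
  proof (cases "a = plurality T p")
    case True
    then show ?thesis using winner_pivotal[OF s] sa by metis
  next
    case False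
    then show ?thesis using contender_pivotal[OF a] by metis
  qed
  then obtain s' where s': "s' \<in> state_ball r p" "plurality T s' \<noteq> a" "plurality T (add_vote s' a) = a"
    by blast
  have "plurality T (add_vote s' d) \<noteq> a"
    using plurality_add_vote[of s' d] s'(2) \<open>a \<noteq> d\<close> by metis
  moreover have "P a \<le> P (plurality T (add_vote s' d))"
    using fav plurality_add_vote_contender[OF s'(1)] by blast
  ultimately have "P a < P (plurality T (add_vote s' d))"
    using strict_ranking_inj[OF P] by (metis order_le_less)
  then have "beats T P (state_ball r p) a d"
    unfolding beats_def using s' by (metis (no_types))
  then show False
    using dom by (simp add: dominates_def)
qed

text \<open>Votes for \<open>a\<close> change nothing, so \<open>d\<close> must win in the state
  where it does better. If \<open>d\<close> were worse than the winner of \<open>p\<close>, then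
  \<open>a\<close> would beat \<open>d\<close> in the state where \<open>d\<close> is pivotal
  against that winner.\<close>

lemma dominating_non_contender:
  assumes a: "a \<notin> contenders T r p" and dom: "dominates T P (state_ball r p) d a"
  shows "d \<in> contenders T r p" and "P d \<le> P (plurality T p)"
proof -
  obtain s where s: "s \<in> state_ball r p"
    and "P (plurality T (add_vote s d)) < P (plurality T (add_vote s a))"
    using dom by (auto simp: dominates_def beats_def)
  then have "plurality T (add_vote s d) \<noteq> plurality T s"
    using non_contender_vote[OF a s] by auto
  then show d: "d \<in> contenders T r p"
    using plurality_add_vote plurality_add_vote_contender[OF s] by metis
  show "P d \<le> P (plurality T p)"
  proof (cases "d = plurality T p")
    case False
    then obtain s' where s': "s' \<in> state_ball r p" "plurality T s' = plurality T p"
      "plurality T (add_vote s' d) = d"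
      using contender_pivotal[OF d] by blast
    then have "plurality T (add_vote s' a) = plurality T p"
      using non_contender_vote[OF a] by metis
    then show ?thesis
      using dom s' by (force simp: dominates_def beats_def not_less)
  qed simp
qed

text \<open>Voting \<open>a\<close> elects the winner of the state, a contender; voting
  \<open>c\<close> elects that winner or \<open>c\<close>, so it never does worse. The pivotal state
  gives the strict gain.\<close>

lemma favourite_contender_dominates:
  assumes P: "strict_ranking P" and a: "a \<notin> contenders T r p"
    and c: "c \<in> contenders T r p" and fav: "\<And>d. d \<in> contenders T r p \<Longrightarrow> P c \<le> P d"
    and ne: "c \<noteq> plurality T p"
  shows "dominates T P (state_ball r p) c a"
proof -
  obtain s where s: "s \<in> state_ball r p" "plurality T s = plurality T p"
    "plurality T (add_vote s c) = c"
    using contender_pivotal[OF c ne] by blast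
  have "plurality T p \<in> contenders T r p"
    using plurality_contender[OF s(1)] s(2) by simp
  then have "P c < P (plurality T p)"
    using fav ne strict_ranking_inj[OF P] by (metis order_le_less)
  then have "beats T P (state_ball r p) c a"
    unfolding beats_def using s non_contender_vote[OF a s(1)] by (metis (no_types))
  moreover have "P (plurality T (add_vote s' c)) \<le> P (plurality T (add_vote s' a))"
    if "s' \<in> state_ball r p" for s'
    using plurality_add_vote[of s' c] non_contender_vote[OF a that]
      fav[OF plurality_contender[OF that]] by auto
  ultimately show ?thesis
    by (auto simp: dominates_def beats_def not_less)
qed

lemma dominating_choice:
  assumes P: "strict_ranking P" and D: "D = {d. dominates T P (state_ball r p) d a}" "D \<noteq> {}"
    and inv: "\<And>c. c \<in> contenders T r p \<Longrightarrow> P a \<le> P c"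
  shows "a \<notin> contenders T r p"
    and "(ARG_MIN P d. d \<in> D) \<in> contenders T r p"
    and "\<And>c. c \<in> contenders T r p \<Longrightarrow> P (ARG_MIN P d. d \<in> D) \<le> P c"
proof -
  let ?W = "contenders T r p" and ?y = "ARG_MIN P d. d \<in> D"
  show a: "a \<notin> ?W"
    using favourite_contender_undominated[OF P _ inv] D by auto
  have y: "?y \<in> D" and y_min: "\<And>d. d \<in> D \<Longrightarrow> P ?y \<le> P d"
    using D(2) arg_min_nat_lemma[of "\<lambda>d. d \<in> D" _ P] by blast+
  show yW: "?y \<in> ?W"
    using dominating_non_contender(1)[OF a] y D(1) by blast
  have y_le: "P ?y \<le> P (plurality T p)"
    using dominating_non_contender(2)[OF a] y D(1) by blast
  obtain c where c: "c \<in> ?W" and fav: "\<And>d. d \<in> ?W \<Longrightarrow> P c \<le> P d"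
    using yW arg_min_nat_lemma[of "\<lambda>d. d \<in> ?W" _ P] by blast
  \<comment> \<open>A favourite contender other than the winner of \<open>p\<close> lies in
    \<open>D\<close> itself. If it is that winner, membership in \<open>D\<close> is not known, but
    everything in \<open>D\<close> is at least as good as the winner.\<close>
  have "P ?y \<le> P c"
  proof (cases "c = plurality T p")
    case False
    then show ?thesis
      using favourite_contender_dominates[OF P a c fav] y_min D(1) by blast
  qed (use y_le in simp)
  then show "\<And>d. d \<in> ?W \<Longrightarrow> P ?y \<le> P d"
    using fav order_trans by blast
qed

text \<open>
  Here \<open>u\<close> collects the votes of all but two voters: one votes for \<open>b\<close>, the other moves from \<open>x\<close>
  to \<open>y\<close>.
\<close>

lemma non_contender_stable:
  assumes x: "x \<notin> contenders T r (add_vote u b)" and y: "y \<in> contenders T r (add_vote u b)"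
    and c: "c \<notin> contenders T r (add_vote u x)" and "c \<noteq> b"
  shows "c \<notin> contenders T r (add_vote u y)"
proof -
  let ?m = "int CARD('c)"
  define B where "B = ?m * (int r + 1)"
  have m: "0 < ?m" by simp
  \<comment> \<open>The case \<open>r = 0\<close> is separated because there the margin
    \<open>B\<close> is worth only one vote.\<close>
  have B: "B = ?m \<and> r = 0 \<or> B \<ge> 2 * ?m"
  proof (cases r)
    case (Suc k)
    then have "?m * 2 \<le> B" unfolding B_def by (intro mult_left_mono) auto
    then show ?thesis by simp
  qed (simp add: B_def)
  have "x \<noteq> y" using x y by auto
  obtain w where w: "weight T (add_vote u b) x + B \<le> weight T (add_vote u b) w"
    using x by (auto simp: contenders_def B_def not_less)
  have y': "weight T (add_vote u b) d < weight T (add_vote u b) y + B" for d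
    using y by (simp add: contenders_def B_def)
  obtain v where v: "weight T (add_vote u x) c + B \<le> weight T (add_vote u x) v"
    using c by (auto simp: contenders_def B_def not_less)
  \<comment> \<open>If \<open>c = y\<close>, only \<open>x\<close> could be \<open>v\<close>, thanks
    to its extra vote. But \<open>w\<close> is \<open>B\<close> ahead of \<open>x\<close> and less
    than \<open>B\<close> ahead of \<open>y\<close>, which leaves \<open>x\<close> too weak.\<close>
  have "c \<noteq> y"
    using v w y'[of v] y'[of w] \<open>x \<noteq> y\<close> \<open>c \<noteq> b\<close> B m
    by (auto simp: weight_add_vote split: if_splits)
  \<comment> \<open>If \<open>v\<close> is not \<open>x\<close>, it loses nothing by the move. If
    \<open>v = x\<close>, then \<open>w\<close> replaces it, except possibly when
    \<open>w = b\<close> and \<open>r = 0\<close>: the lead of \<open>w\<close> may then rest on the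
    vote for \<open>b\<close>, which is not counted here, and \<open>y\<close> with its new vote
    takes over.\<close>
  have "\<exists>v'\<in>{v, w, y}. weight T (add_vote u y) c + B \<le> weight T (add_vote u y) v'"
    using v w y'[of w] \<open>x \<noteq> y\<close> \<open>c \<noteq> b\<close> \<open>c \<noteq> y\<close> B m
    by (auto simp: weight_add_vote split: if_splits)
  then show ?thesis
    by (auto simp: contenders_def B_def not_less)
qed

end

section \<open>The invariant and its preservation\<close>

definition compromising :: "'v set \<Rightarrow> ('v \<Rightarrow> 'c::finite ranking) \<Rightarrow> 'c ranking \<Rightarrow> nat \<Rightarrow> ('v, 'c) profile \<Rightarrow> bool"
  where "compromising N Q T r a \<longleftrightarrow>
    (\<forall>i\<in>N. \<forall>c\<in>contenders T r (score (N - {i}) a). Q i (a i) \<le> Q i c)"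

lemma response_contender:
  assumes T: "strict_ranking T" and P: "strict_ranking (Q i)" and i: "i \<in> N"
    and inv: "compromising N Q T r a" and move: "response N Q T r i a \<noteq> a i"
  defines "W \<equiv> contenders T r (score (N - {i}) a)" and "y \<equiv> response N Q T r i a"
  shows "a i \<notin> W" and "y \<in> W" and "\<And>c. c \<in> W \<Longrightarrow> Q i y \<le> Q i c" and "Q i (a i) < Q i y"
proof -
  define D where "D = {d. dominates T (Q i) (state_ball r (score (N - {i}) a)) d (a i)}"
  have y: "y = (if D \<noteq> {} then (ARG_MIN (Q i) d. d \<in> D) else a i)"
    by (simp add: y_def response_def possible_states_eq D_def)
  then have D: "D \<noteq> {}" and y: "y = (ARG_MIN (Q i) d. d \<in> D)"
    using move unfolding y_def by (auto split: if_splits)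
  have inv': "Q i (a i) \<le> Q i c" if "c \<in> W" for c
    using inv i that by (simp add: compromising_def W_def)
  note choice = dominating_choice[OF T P D_def D, folded W_def, OF inv', folded y]
  show "a i \<notin> W" "y \<in> W" "\<And>c. c \<in> W \<Longrightarrow> Q i y \<le> Q i c"
    using choice by blast+
  have "Q i (a i) \<noteq> Q i y"
    using strict_ranking_inj[OF P] move unfolding y_def by metis
  then show "Q i (a i) < Q i y"
    using inv'[OF \<open>y \<in> W\<close>] by simp
qed

text \<open>The mover's own view ignores her vote, so her contenders are unchanged and she now votes
  for the best of them. For another voter, any candidate better than \<open>a i\<close> differs from
  \<open>a i\<close>, so \<open>non_contender_stable\<close> applies with \<open>b = a i\<close> and
  \<open>x = a j\<close>.\<close>

lemma compromising_step:
  assumes fin: "finite N" and Q: "\<forall>i\<in>N. strict_ranking (Q i)" and T: "strict_ranking T"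
    and inv: "compromising N Q T r a" and j: "j \<in> N" and move: "response N Q T r j a \<noteq> a j"
  shows "compromising N Q T r (a(j := response N Q T r j a))"
  unfolding compromising_def
proof (intro ballI)
  let ?y = "response N Q T r j a"
  let ?a = "a(j := ?y)"
  fix i c
  assume i: "i \<in> N" and c: "c \<in> contenders T r (score (N - {i}) ?a)"
  note resp = response_contender[OF T _ j inv move]
  show "Q i (?a i) \<le> Q i c"
  proof (cases "i = j")
    case True
    then have "c \<in> contenders T r (score (N - {j}) a)"
      using c by (simp add: score_upd_outside)
    then show ?thesis
      using resp(3) Q j True by simp
  next
    case False
    define u where "u = score (N - {i} - {j}) a"
    have pi: "score (N - {i}) a = add_vote u (a j)"
      using score_insert_voter[of "N - {i}" j a] fin j False by (simp add: u_def)
    have pi': "score (N - {i}) ?a = add_vote u ?y"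
      using score_insert_voter[of "N - {i}" j ?a] fin j False by (simp add: u_def score_upd_outside)
    have "N - {j} - {i} = N - {i} - {j}" by blast
    then have pj: "score (N - {j}) a = add_vote u (a i)"
      using score_insert_voter[of "N - {j}" i a] fin i False by (simp add: u_def)
    have "Q i (a i) \<le> Q i c"
    proof (rule ccontr)
      assume less: "\<not> Q i (a i) \<le> Q i c"
      then have "c \<noteq> a i" by auto
      moreover have "c \<notin> contenders T r (add_vote u (a j))"
        using inv i less unfolding compromising_def pi[symmetric] by blast
      ultimately have "c \<notin> contenders T r (add_vote u ?y)"
        using non_contender_stable[OF T] resp(1,2) Q j unfolding pj by blast
      then show False
        using c unfolding pi' by simp
    qed
    then show ?thesis
      using False by simp
  qed
qed

section \<open>Potential argument and convergence\<close>

text \<open>Counting ranks from 0 caps each voter's share at \<open>CARD('c) - 1\<close>. The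
  truncated subtraction is exact because strict rankings start at 1.\<close>

definition total_rank :: "'v set \<Rightarrow> ('v \<Rightarrow> 'c ranking) \<Rightarrow> ('v, 'c) profile \<Rightarrow> nat" where
  "total_rank N Q a = (\<Sum>i\<in>N. Q i (a i) - 1)"

lemma total_rank_step:
  assumes fin: "finite N" and Q: "\<forall>i\<in>N. strict_ranking (Q i)" and T: "strict_ranking T"
    and inv: "compromising N Q T r a" and j: "j \<in> N" and move: "response N Q T r j a \<noteq> a j"
  shows "total_rank N Q a < total_rank N Q (a(j := response N Q T r j a))"
proof -
  have "Q j (a j) < Q j (response N Q T r j a)" and "1 \<le> Q j (a j)"
    using response_contender(4)[OF T _ j inv move] Q j strict_ranking_range by blast+
  then have "Q j (a j) - 1 < Q j (response N Q T r j a) - 1" by simp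
  then show ?thesis
    unfolding total_rank_def
    by (intro sum_strict_mono_ex1 fin ballI bexI[OF _ j]) auto
qed

lemma total_rank_le:
  fixes Q :: "'v \<Rightarrow> 'c::finite ranking"
  assumes "\<forall>i\<in>N. strict_ranking (Q i)"
  shows "total_rank N Q a \<le> card N * (CARD('c) - 1)"
proof -
  have "total_rank N Q a \<le> of_nat (card N) * (CARD('c) - 1)"
    unfolding total_rank_def
    by (rule sum_bounded_above) (use assms strict_ranking_range in \<open>auto intro!: diff_le_mono\<close>)
  then show ?thesis by simp
qed

lemma compromising_truthful:
  assumes "\<forall>i\<in>N. strict_ranking (Q i)"
  shows "compromising N Q T r (\<lambda>i. top_choice (Q i))"
  unfolding compromising_def using assms by (metis rank_top_choice strict_ranking_range)

text \<open>A compromising profile of greatest total rank admits no move, since a move would keep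
  the invariant and raise the total.\<close>

lemma voting_equilibrium_exists:
  fixes Q :: "'v \<Rightarrow> 'c::finite ranking"
  assumes fin: "finite N" and Q: "\<forall>i\<in>N. strict_ranking (Q i)" and T: "strict_ranking T"
  shows "\<exists>a. voting_equilibrium N Q T r a"
proof -
  have "\<forall>a. compromising N Q T r a \<longrightarrow> total_rank N Q a < Suc (card N * (CARD('c) - 1))"
    using total_rank_le[OF Q] by (simp add: less_Suc_eq_le)
  then obtain a where a: "compromising N Q T r a"
    and max: "\<And>b. compromising N Q T r b \<Longrightarrow> total_rank N Q b \<le> total_rank N Q a"
    using ex_has_greatest_nat[of "compromising N Q T r" _ "total_rank N Q"]
      compromising_truthful[OF Q] by blast
  have "response N Q T r i a = a i" if "i \<in> N" for i
    using max[OF compromising_step[OF fin Q T a that]] total_rank_step[OF fin Q T a that]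
    by (meson not_le)
  then show ?thesis
    unfolding voting_equilibrium_def by blast
qed

lemma singleton_iteration_converges:
  fixes Q :: "'v \<Rightarrow> 'c::finite ranking"
  assumes fin: "finite N" and Q: "\<forall>i\<in>N. strict_ranking (Q i)" and T: "strict_ranking T"
    and inv: "compromising N Q T r a" and iter: "singleton_iteration N Q T r a \<sigma> A"
  shows "\<exists>k \<le> card N * (CARD('c) - 1).
    voting_equilibrium N Q T r (A k) \<and> (\<forall>t\<ge>k. A t = A k)"
proof -
  let ?E = "voting_equilibrium N Q T r" and ?B = "card N * (CARD('c) - 1)"
  have stop: "A (Suc t) = A t" if "?E (A t)" for t
    using iter that unfolding singleton_iteration_def voting_equilibrium_def by metis
  have step: "\<sigma> t \<in> N" "response N Q T r (\<sigma> t) (A t) \<noteq> A t (\<sigma> t)"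
    "A (Suc t) = (A t)(\<sigma> t := response N Q T r (\<sigma> t) (A t))" if "\<not> ?E (A t)" for t
    using iter that unfolding singleton_iteration_def voting_equilibrium_def by metis+
  have comp: "compromising N Q T r (A t)" for t
  proof (induction t)
    case 0
    then show ?case using inv iter by (simp add: singleton_iteration_def)
  next
    case (Suc t)
    then show ?case
      using stop step compromising_step[OF fin Q T] by (cases "?E (A t)") metis+
  qed
  have "\<exists>k\<le>?B. ?E (A k)"
  proof (rule ccontr)
    assume neg: "\<not> ?thesis"
    \<comment> \<open>Without an equilibrium among the profiles at times up to \<open>?B\<close>,
      each of the first \<open>Suc ?B\<close> steps is a genuine move, which pushes the total beyond
      its bound.\<close>
    have "t \<le> total_rank N Q (A t)" if "t \<le> Suc ?B" for t
      using that
    proof (induction t)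
      case (Suc t)
      then have "\<not> ?E (A t)" using neg by simp
      then have "total_rank N Q (A t) < total_rank N Q (A (Suc t))"
        using step total_rank_step[OF fin Q T comp] by metis
      then show ?case using Suc by simp
    qed simp
    from this[of "Suc ?B"] show False
      using total_rank_le[OF Q, of "A (Suc ?B)"] by simp
  qed
  then obtain k where k: "k \<le> ?B" "?E (A k)" by blast
  have "A t = A k" if "t \<ge> k" for t
    using that by (induction t rule: dec_induct) (use k stop in auto)
  then show ?thesis
    using k by blast
qed

theorem theorem4:
  fixes N :: "'v set" and Q :: "'v \<Rightarrow> 'c::finite ranking" and T :: "'c ranking" and r :: nat
  assumes "finite N"
    and "\<forall>i\<in>N. strict_ranking (Q i)"
    and "strict_ranking T"
  shows "(\<exists>a. voting_equilibrium N Q T r a) \<and>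
    (\<forall>\<sigma> A. singleton_iteration N Q T r (\<lambda>i. top_choice (Q i)) \<sigma> A \<longrightarrow>
      (\<exists>k \<le> card N * (CARD('c) - 1).
        voting_equilibrium N Q T r (A k) \<and> (\<forall>t\<ge>k. A t = A k)))"
  using voting_equilibrium_exists[OF assms]
    singleton_iteration_converges[OF assms compromising_truthful[OF assms(2)]] by blast

end
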